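(* Let $G$ be a graph on which there exists a time dependent protective strategy for the cop. Then $G$ is constructible.
   Context: Graphs are undirected and reflexive (there is a loop at every vertex); they may be infinite and need not be locally finite. Constructible: a vertex $\mu\neq\nu$ dominates $\nu$ in a graph if $\mu$ is adjacent to $\nu$ and to all neighbours of $\nu$. For a well order $<$ on the vertex set $V$ of $G$, $G_{\le\nu}$ denotes the subgraph of $G$ induced by $\{\gamma\in V:\gamma\le\nu\}$. $G$ is constructible if there is a well order $<$ on $V$ such that each vertex $\nu$ other than the least one is dominated in $G_{\le \nu}$ by some vertex of $G_{\le\nu}$. The game: two players, the cop and the robber, have perfect information and move in rounds $0,1,2,\dots$; the cop plays in even rounds, the robber in odd rounds. In round $0$ the cop chooses a starting vertex, in round $1$ the robber chooses a starting vertex; in each later round the player whose turn it is moves to a neighbour of their current vertex (because of the loops, staying put is allowed). The robber is caught (and the game ends) as soon as both players occupy the same vertex. A time dependent strategy of the cop is a choice of starting vertex together with a map $s\colon V\times V\times\mathbb N\to V$ assigning to $(c,r,t)$ a neighbour of $c$: when it is the cop's turn, the cop is at $c$, the robber is at $r$, and $t$ is the number of the current round, she moves to $s(c,r,t)$. Protective: the robber robs a vertex $\nu$ at time $n$ if he is at $\nu$ (uncaught) after round $n$ and does not get caught in round $n+1$. For a (possibly time dependent) strategy $s$ of the cop and a vertex $\nu$, let $$t_r^s(\nu)=\sup\{t\in\mathbb N\mid \text{the robber robs }\nu\text{ at time }t\},\qquad t_c^s(\nu)=\inf\{t\in\mathbb N\mid\text{the cop is at }\nu\text{ after round }t\},$$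 where the cop plays $s$ and the supremum, respectively infimum, is taken over $t$ and over all possible strategies (ways of playing) of the robber; $\sup\emptyset=-\infty$ and $\inf\emptyset=\infty$. The strategy $s$ is protective if $t_r^s(\nu)<t_c^s(\nu)<\infty$ for every $\nu\in V$. *)

theory Defs
  imports "HOL-Library.Extended_Real"
begin

text \<open>A graph is given by its vertex set and its adjacency relation, which contains a loop at
  every vertex. No finiteness is assumed.\<close>

locale reflexive_graph =
  fixes V :: "'a set" and E :: "'a rel"
  assumes edges_in_vertices: "E \<subseteq> V \<times> V"
    and edges_refl: "refl_on V E"
    and edges_sym: "sym E"

definition dominates :: "'a rel \<Rightarrow> 'a \<Rightarrow> 'a \<Rightarrow> bool" where
  "dominates E \<mu> \<nu> \<longleftrightarrow> \<mu> \<noteq> \<nu> \<and> (\<mu>, \<nu>) \<in> E \<and> (\<forall>\<gamma>. (\<nu>, \<gamma>) \<in> E \<longrightarrow> (\<mu>, \<gamma>) \<in> E)"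

text \<open>The library's well orders are reflexive relations, so \<open>under r \<nu>\<close> is the set of all
  vertices \<open>\<gamma> \<le> \<nu>\<close> including \<open>\<nu>\<close>, and \<open>Restr E (under r \<nu>)\<close> is the adjacency relation of the
  subgraph it induces.\<close>

definition constructible :: "'a set \<Rightarrow> 'a rel \<Rightarrow> bool" where
  "constructible V E \<longleftrightarrow>
    (\<exists>r. well_order_on V r \<and>
      (\<forall>\<nu>\<in>V. \<not> (\<forall>\<gamma>\<in>V. (\<nu>, \<gamma>) \<in> r) \<longrightarrow>
        (\<exists>\<mu>\<in>under r \<nu>. dominates (Restr E (under r \<nu>)) \<mu> \<nu>)))"

text \<open>A time dependent strategy: \<open>c0\<close> is the starting vertex, and \<open>s c r t\<close> is the vertex the cop
  moves to in round \<open>t\<close> when she is at \<open>c\<close> and the robber is at \<open>r\<close>.\<close>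

definition cop_strategy :: "'a set \<Rightarrow> 'a rel \<Rightarrow> 'a \<Rightarrow> ('a \<Rightarrow> 'a \<Rightarrow> nat \<Rightarrow> 'a) \<Rightarrow> bool" where
  "cop_strategy V E c0 s \<longleftrightarrow> c0 \<in> V \<and> (\<forall>c\<in>V. \<forall>r\<in>V. \<forall>t. (c, s c r t) \<in> E)"

text \<open>As the cop's strategy is a fixed function, a way of playing of the robber is determined by the
  sequence of his positions: \<open>\<rho> n\<close> is his vertex after round \<open>n\<close>, for \<open>n \<ge> 1\<close> (the value \<open>\<rho> 0\<close> has
  no meaning). The sequence is continued arbitrarily after the robber has been caught; positions
  in rounds after the end of the game are disregarded by means of \<open>running\<close> below.\<close>

definition robber_play :: "'a set \<Rightarrow> 'a rel \<Rightarrow> (nat \<Rightarrow> 'a) \<Rightarrow> bool" where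
  "robber_play V E \<rho> \<longleftrightarrow> \<rho> 1 \<in> V \<and>
    (\<forall>n\<ge>1. if even (Suc n) then \<rho> (Suc n) = \<rho> n else (\<rho> n, \<rho> (Suc n)) \<in> E)"

text \<open>The cop's vertex after each round, when she plays \<open>(c0, s)\<close> against \<open>\<rho>\<close>.\<close>

primrec cop_at :: "'a \<Rightarrow> ('a \<Rightarrow> 'a \<Rightarrow> nat \<Rightarrow> 'a) \<Rightarrow> (nat \<Rightarrow> 'a) \<Rightarrow> nat \<Rightarrow> 'a" where
  "cop_at c0 s \<rho> 0 = c0"
| "cop_at c0 s \<rho> (Suc n) =
    (if even (Suc n) then s (cop_at c0 s \<rho> n) (\<rho> n) (Suc n) else cop_at c0 s \<rho> n)"

text \<open>The robber is uncaught after round \<open>n\<close>. In round \<open>0\<close> he is not yet on the graph.\<close>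

definition running :: "'a \<Rightarrow> ('a \<Rightarrow> 'a \<Rightarrow> nat \<Rightarrow> 'a) \<Rightarrow> (nat \<Rightarrow> 'a) \<Rightarrow> nat \<Rightarrow> bool" where
  "running c0 s \<rho> n \<longleftrightarrow> (\<forall>m. 1 \<le> m \<and> m \<le> n \<longrightarrow> cop_at c0 s \<rho> m \<noteq> \<rho> m)"

definition robs :: "'a \<Rightarrow> ('a \<Rightarrow> 'a \<Rightarrow> nat \<Rightarrow> 'a) \<Rightarrow> (nat \<Rightarrow> 'a) \<Rightarrow> 'a \<Rightarrow> nat \<Rightarrow> bool" where
  "robs c0 s \<rho> \<nu> n \<longleftrightarrow> 1 \<le> n \<and> \<rho> n = \<nu> \<and> running c0 s \<rho> n \<and> running c0 s \<rho> (Suc n)"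

text \<open>Round \<open>t\<close> takes place iff the robber is uncaught after every earlier round.\<close>

definition cop_visits :: "'a \<Rightarrow> ('a \<Rightarrow> 'a \<Rightarrow> nat \<Rightarrow> 'a) \<Rightarrow> (nat \<Rightarrow> 'a) \<Rightarrow> 'a \<Rightarrow> nat \<Rightarrow> bool" where
  "cop_visits c0 s \<rho> \<nu> t \<longleftrightarrow> cop_at c0 s \<rho> t = \<nu> \<and> (\<forall>m<t. running c0 s \<rho> m)"

text \<open>In \<^typ>\<open>ereal\<close> the supremum of the empty set is \<open>-\<infinity>\<close> and its infimum is \<open>\<infinity>\<close>.\<close>

definition last_robbed ::
    "'a set \<Rightarrow> 'a rel \<Rightarrow> 'a \<Rightarrow> ('a \<Rightarrow> 'a \<Rightarrow> nat \<Rightarrow> 'a) \<Rightarrow> 'a \<Rightarrow> ereal" where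
  "last_robbed V E c0 s \<nu> =
    (SUP t \<in> {t. \<exists>\<rho>. robber_play V E \<rho> \<and> robs c0 s \<rho> \<nu> t}. ereal (real t))"

definition first_visited ::
    "'a set \<Rightarrow> 'a rel \<Rightarrow> 'a \<Rightarrow> ('a \<Rightarrow> 'a \<Rightarrow> nat \<Rightarrow> 'a) \<Rightarrow> 'a \<Rightarrow> ereal" where
  "first_visited V E c0 s \<nu> =
    (INF t \<in> {t. \<exists>\<rho>. robber_play V E \<rho> \<and> cop_visits c0 s \<rho> \<nu> t}. ereal (real t))"

definition protective :: "'a set \<Rightarrow> 'a rel \<Rightarrow> 'a \<Rightarrow> ('a \<Rightarrow> 'a \<Rightarrow> nat \<Rightarrow> 'a) \<Rightarrow> bool" where
  "protective V E c0 s \<longleftrightarrow>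
    (\<forall>\<nu>\<in>V. last_robbed V E c0 s \<nu> < first_visited V E c0 s \<nu> \<and> first_visited V E c0 s \<nu> < \<infinity>)"

end

theory Submission
  imports Defs
begin

text \<open>
  Rank each vertex by the earliest round \<open>T \<nu>\<close> in which some play of the robber brings the cop to
  \<open>\<nu>\<close>; protectiveness makes \<open>T\<close> a function into the natural numbers. Any well order of the vertices
  that refines \<open>T\<close> witnesses constructibility.

  Let \<open>\<nu>\<close> be different from the starting vertex of the cop, and let \<open>n = T \<nu>\<close>, which is even because
  the cop moves in even rounds only. Let the robber wait at \<open>\<nu>\<close>. The cop cannot reach \<open>\<nu>\<close> before round
  \<open>n\<close>, so he survives; let \<open>\<mu>\<close> be her vertex after round \<open>n - 2\<close>, so that \<open>T \<mu> < T \<nu>\<close>. Now suppose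
  that in round \<open>n - 1\<close> the robber steps to a neighbour \<open>\<gamma>\<close> of \<open>\<nu>\<close> with \<open>T \<gamma> \<le> n\<close>, and
  remains there. If he survived round \<open>n\<close>, he would rob \<open>\<gamma>\<close> at time \<open>n \<ge> T \<gamma>\<close>, against
  protectiveness. So she catches him at \<open>\<gamma>\<close> by round \<open>n\<close>. She had to fix her position \<open>\<mu>\<close> before he
  chose \<open>\<gamma>\<close>, and hence the one vertex \<open>\<mu>\<close> is adjacent to all these \<open>\<gamma>\<close>, including \<open>\<nu>\<close> itself: it
  dominates \<open>\<nu>\<close> in the subgraph induced by the vertices of rank at most \<open>T \<nu>\<close>, and therefore also
  among the vertices up to \<open>\<nu>\<close>. This is the lemma \<open>dominating_cop_position\<close>.
\<close>

text \<open>Sort lexicographically, by \<open>f\<close> and then by an arbitrary well order of \<open>A\<close>.\<close>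

lemma ex_well_order_refining_rank:
  fixes f :: "'a \<Rightarrow> nat"
  obtains r where "well_order_on A r"
    and "\<And>x y. (x, y) \<in> r \<Longrightarrow> f x \<le> f y"
    and "\<And>x y. x \<in> A \<Longrightarrow> y \<in> A \<Longrightarrow> f x < f y \<Longrightarrow> (x, y) \<in> r"
proof -
  obtain r0 where r0: "well_order_on A r0"
    using well_order_on by blast
  define r where "r = {(x, y) \<in> A \<times> A. f x < f y \<or> f x = f y \<and> (x, y) \<in> r0}"
  have refl: "refl_on A r0" and tr: "trans r0" and anti: "antisym r0" and tot: "total_on A r0"
    and wf: "wf (r0 - Id)"
    using r0 by (auto simp: order_on_defs)
  have "r - Id \<subseteq> inv_image (less_than <*lex*> (r0 - Id)) (\<lambda>x. (f x, x))"
    by (auto simp: r_def)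
  moreover have "wf (inv_image (less_than <*lex*> (r0 - Id)) (\<lambda>x. (f x, x)))"
    using wf by (intro wf_inv_image wf_lex_prod) auto
  ultimately have "wf (r - Id)"
    by (rule wf_subset[rotated])
  moreover have "refl_on A r"
    using refl by (auto simp: r_def refl_on_def)
  moreover have "trans r"
    using tr by (auto simp: r_def trans_def)
  moreover have "antisym r"
    using anti by (auto simp: r_def antisym_def)
  moreover have "total_on A r"
    using tot by (auto simp: r_def total_on_def)
  moreover have "r \<subseteq> A \<times> A"
    by (auto simp: r_def)
  ultimately have "well_order_on A r"
    by (simp add: order_on_defs)
  then show thesis
    by (rule that) (auto simp: r_def)
qed

lemma cop_at_cong:
  assumes "\<And>m. m < n \<Longrightarrow> \<rho> m = \<rho>' m"
  shows "cop_at c0 s \<rho> n = cop_at c0 s \<rho>' n"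
  using assms by (induction n) auto

lemma cop_at_in_vertices:
  assumes "reflexive_graph V E" "cop_strategy V E c0 s" "robber_play V E \<rho>"
  shows "cop_at c0 s \<rho> n \<in> V"
proof -
  have robber: "\<rho> (Suc n) \<in> V" for n
  proof (induction n)
    case 0
    then show ?case
      using assms(3) by (simp add: robber_play_def)
  next
    case (Suc n)
    have "if even (Suc (Suc n)) then \<rho> (Suc (Suc n)) = \<rho> (Suc n)
          else (\<rho> (Suc n), \<rho> (Suc (Suc n))) \<in> E"
      using assms(3) unfolding robber_play_def by (metis le_add1 plus_1_eq_Suc)
    then show ?case
      using Suc assms(1) by (auto simp: reflexive_graph_def split: if_splits)
  qed
  show ?thesis
  proof (induction n)
    case 0
    then show ?case
      using assms(2) by (simp add: cop_strategy_def)
  next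
    case (Suc n)
    show ?case
    proof (cases "even (Suc n)")
      case True
      then obtain k where "n = Suc k"
        by (cases n) auto
      then have "\<rho> n \<in> V"
        using robber by simp
      then have "(cop_at c0 s \<rho> n, cop_at c0 s \<rho> (Suc n)) \<in> E"
        using Suc assms(2) True by (simp add: cop_strategy_def)
      then show ?thesis
        using assms(1) by (auto simp: reflexive_graph_def)
    next
      case False
      then show ?thesis
        using Suc by simp
    qed
  qed
qed

text \<open>A robber who waits at \<open>\<nu>\<close> and then, in round \<open>n - 1\<close>, steps to a neighbour \<open>\<gamma>\<close> and waits there.
  If \<open>n = 2\<close>, he starts at \<open>\<gamma>\<close>; if \<open>\<gamma> = \<nu>\<close>, he never moves.\<close>

definition wait_then_step :: "'a \<Rightarrow> 'a \<Rightarrow> nat \<Rightarrow> nat \<Rightarrow> 'a" where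
  "wait_then_step \<nu> \<gamma> n k = (if Suc k < n then \<nu> else \<gamma>)"

lemma robber_play_wait_then_step:
  assumes "reflexive_graph V E" "(\<nu>, \<gamma>) \<in> E" "even n"
  shows "robber_play V E (wait_then_step \<nu> \<gamma> n)"
proof -
  have "\<nu> \<in> V" "\<gamma> \<in> V" "(\<nu>, \<nu>) \<in> E" "(\<gamma>, \<gamma>) \<in> E"
    using assms(1,2) by (auto simp: reflexive_graph_def refl_on_def)
  moreover have "\<not> Suc (Suc k) < n \<Longrightarrow> Suc k < n \<Longrightarrow> odd (Suc k)" for k
    using assms(3) by (metis Suc_lessI even_Suc)
  ultimately show ?thesis
    using assms(2) by (auto simp: robber_play_def wait_then_step_def)
qed

text \<open>The time \<open>t\<^sub>c(\<nu>)\<close> as a natural number: the least element of a nonempty set, once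
  \<open>first_visited\<close> is known to be finite.\<close>

definition visit_time ::
    "'a set \<Rightarrow> 'a rel \<Rightarrow> 'a \<Rightarrow> ('a \<Rightarrow> 'a \<Rightarrow> nat \<Rightarrow> 'a) \<Rightarrow> 'a \<Rightarrow> nat" where
  "visit_time V E c0 s \<nu> = (LEAST t. \<exists>\<rho>. robber_play V E \<rho> \<and> cop_visits c0 s \<rho> \<nu> t)"

lemma visit_time_le:
  "robber_play V E \<rho> \<Longrightarrow> cop_visits c0 s \<rho> \<nu> t \<Longrightarrow> visit_time V E c0 s \<nu> \<le> t"
  unfolding visit_time_def by (rule Least_le) blast

lemma visit_time_attained:
  assumes "protective V E c0 s" "\<nu> \<in> V"
  obtains \<rho> where "robber_play V E \<rho>" "cop_visits c0 s \<rho> \<nu> (visit_time V E c0 s \<nu>)"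
proof -
  have "first_visited V E c0 s \<nu> < \<infinity>"
    using assms by (simp add: protective_def)
  then have "\<exists>t \<rho>. robber_play V E \<rho> \<and> cop_visits c0 s \<rho> \<nu> t"
    unfolding first_visited_def INF_less_iff by blast
  then have "\<exists>\<rho>. robber_play V E \<rho> \<and> cop_visits c0 s \<rho> \<nu> (visit_time V E c0 s \<nu>)"
    unfolding visit_time_def by (rule LeastI_ex)
  then show thesis
    using that by blast
qed

lemma robs_before_visit_time:
  assumes "protective V E c0 s" "\<nu> \<in> V" "robber_play V E \<rho>" "robs c0 s \<rho> \<nu> n"
  shows "n < visit_time V E c0 s \<nu>"
proof -
  obtain \<rho>' where "robber_play V E \<rho>'" "cop_visits c0 s \<rho>' \<nu> (visit_time V E c0 s \<nu>)"
    using visit_time_attained assms(1,2) .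
  then have "first_visited V E c0 s \<nu> \<le> ereal (real (visit_time V E c0 s \<nu>))"
    unfolding first_visited_def by (intro INF_lower) auto
  moreover have "ereal (real n) \<le> last_robbed V E c0 s \<nu>"
    unfolding last_robbed_def using assms(3,4) by (intro SUP_upper) auto
  moreover have "last_robbed V E c0 s \<nu> < first_visited V E c0 s \<nu>"
    using assms(1,2) by (simp add: protective_def)
  ultimately have "ereal (real n) < ereal (real (visit_time V E c0 s \<nu>))"
    by order
  then show ?thesis
    by simp
qed

lemma visit_time_eq_0_iff:
  assumes "reflexive_graph V E" "protective V E c0 s" "\<nu> \<in> V"
  shows "visit_time V E c0 s \<nu> = 0 \<longleftrightarrow> \<nu> = c0"
proof
  assume "visit_time V E c0 s \<nu> = 0"
  then show "\<nu> = c0"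
    using visit_time_attained[OF assms(2,3)] by (auto simp: cop_visits_def)
next
  assume "\<nu> = c0"
  moreover have "robber_play V E (wait_then_step \<nu> \<nu> 0)"
    using assms(1,3) by (intro robber_play_wait_then_step) (auto simp: reflexive_graph_def refl_on_def)
  ultimately have "visit_time V E c0 s \<nu> \<le> 0"
    by (intro visit_time_le) (auto simp: cop_visits_def)
  then show "visit_time V E c0 s \<nu> = 0"
    by simp
qed

text \<open>After an odd round the cop is where she already was one round before.\<close>

lemma even_visit_time:
  assumes "protective V E c0 s" "\<nu> \<in> V"
  shows "even (visit_time V E c0 s \<nu>)"
proof (rule ccontr)
  assume odd: "odd (visit_time V E c0 s \<nu>)"
  then obtain k where k: "visit_time V E c0 s \<nu> = Suc k" "even k"
    by (metis even_Suc odd_Suc_minus_one)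
  obtain \<rho> where "robber_play V E \<rho>" "cop_visits c0 s \<rho> \<nu> (Suc k)"
    using visit_time_attained assms k(1) by metis
  then have "visit_time V E c0 s \<nu> \<le> k"
    using k(2) by (intro visit_time_le) (auto simp: cop_visits_def)
  then show False
    using k(1) by simp
qed

text \<open>As the cop cannot be at \<open>\<nu>\<close> before its visit time, waiting at \<open>\<nu>\<close> is safe until then.\<close>

lemma running_wait_until_visit_time:
  assumes "reflexive_graph V E" "\<nu> \<in> V" "m < visit_time V E c0 s \<nu>"
  shows "running c0 s (\<lambda>_. \<nu>) m"
  using assms(3)
proof (induction m)
  case 0
  then show ?case
    by (simp add: running_def)
next
  case (Suc m)
  have play: "robber_play V E (\<lambda>_. \<nu>)"
    using assms(1,2) by (auto simp: robber_play_def reflexive_graph_def refl_on_def)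
  have running: "running c0 s (\<lambda>_. \<nu>) m"
    using Suc by simp
  then have "\<forall>k<Suc m. running c0 s (\<lambda>_. \<nu>) k"
    by (auto simp: running_def)
  then have "cop_at c0 s (\<lambda>_. \<nu>) (Suc m) \<noteq> \<nu>"
    using visit_time_le[OF play, of c0 s \<nu> "Suc m"] Suc.prems
    by (auto simp: cop_visits_def simp del: cop_at.simps)
  then show ?case
    using running by (auto simp: running_def le_Suc_eq)
qed

text \<open>The cop's vertex \<open>\<mu>\<close> is her answer to a robber waiting at \<open>\<nu>\<close>, two rounds before the visit time
  of \<open>\<nu>\<close>. It does not depend on \<open>\<gamma>\<close>, which the robber picks only afterwards.\<close>

lemma dominating_cop_position:
  assumes graph: "reflexive_graph V E" and strat: "cop_strategy V E c0 s"
    and prot: "protective V E c0 s" and \<nu>: "\<nu> \<in> V" "\<nu> \<noteq> c0"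
  obtains \<mu> where "\<mu> \<in> V" "visit_time V E c0 s \<mu> < visit_time V E c0 s \<nu>"
    and "\<And>\<gamma>. (\<nu>, \<gamma>) \<in> E \<Longrightarrow> visit_time V E c0 s \<gamma> \<le> visit_time V E c0 s \<nu> \<Longrightarrow> (\<mu>, \<gamma>) \<in> E"
proof -
  let ?T = "visit_time V E c0 s"
  have "?T \<nu> \<noteq> 0" "even (?T \<nu>)"
    using visit_time_eq_0_iff[OF graph prot] even_visit_time[OF prot] \<nu> by auto
  then obtain k where k: "?T \<nu> = Suc (Suc k)" "even k"
    by (metis even_Suc not0_implies_Suc even_zero)
  define \<mu> where "\<mu> = cop_at c0 s (\<lambda>_. \<nu>) k"
  have play: "robber_play V E (\<lambda>_. \<nu>)"
    using graph \<nu>(1) by (auto simp: robber_play_def reflexive_graph_def refl_on_def)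
  have waiting: "running c0 s (\<lambda>_. \<nu>) m" if "m \<le> k" for m
    using running_wait_until_visit_time[OF graph \<nu>(1)] that k(1) by simp
  have \<mu>_V: "\<mu> \<in> V"
    unfolding \<mu>_def by (rule cop_at_in_vertices[OF graph strat play])
  have "?T \<mu> \<le> k"
    using waiting by (intro visit_time_le[OF play]) (auto simp: cop_visits_def \<mu>_def)
  then have \<mu>_earlier: "?T \<mu> < ?T \<nu>"
    using k(1) by simp
  have \<mu>_adj: "(\<mu>, \<gamma>) \<in> E" if \<gamma>: "(\<nu>, \<gamma>) \<in> E" "?T \<gamma> \<le> ?T \<nu>" for \<gamma>
  proof (rule ccontr)
    assume nonadj: "(\<mu>, \<gamma>) \<notin> E"
    define \<rho> where "\<rho> = wait_then_step \<nu> \<gamma> (Suc (Suc k))"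
    have \<rho>_early: "\<rho> m = \<nu>" if "m \<le> k" for m
      using that by (simp add: \<rho>_def wait_then_step_def)
    have \<rho>_late: "\<rho> m = \<gamma>" if "k < m" for m
      using that by (simp add: \<rho>_def wait_then_step_def)
    have \<gamma>_V: "\<gamma> \<in> V"
      using graph \<gamma>(1) by (auto simp: reflexive_graph_def)
    have play_\<rho>: "robber_play V E \<rho>"
      unfolding \<rho>_def using k(2) by (intro robber_play_wait_then_step[OF graph \<gamma>(1)]) auto
    have same: "cop_at c0 s \<rho> m = cop_at c0 s (\<lambda>_. \<nu>) m" if "m \<le> k" for m
      using that \<rho>_early by (intro cop_at_cong) auto
    have "\<mu> \<noteq> \<gamma>"
      using nonadj graph \<gamma>_V by (auto simp: reflexive_graph_def refl_on_def)
    have c1: "cop_at c0 s \<rho> (Suc k) = \<mu>"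
      using same[of k] k(2) by (simp add: \<mu>_def)
    have c2: "(\<mu>, cop_at c0 s \<rho> (Suc (Suc k))) \<in> E"
      using c1 k(2) strat \<mu>_V \<gamma>_V \<rho>_late by (simp add: cop_strategy_def)
    have c3: "cop_at c0 s \<rho> (Suc (Suc (Suc k))) = cop_at c0 s \<rho> (Suc (Suc k))"
      using k(2) by simp
    have "running c0 s \<rho> k"
      using waiting[of k] same \<rho>_early by (auto simp: running_def)
    moreover have "cop_at c0 s \<rho> m \<noteq> \<rho> m" if "m \<in> {Suc k, Suc (Suc k), Suc (Suc (Suc k))}" for m
      using that c1 c2 c3 \<open>\<mu> \<noteq> \<gamma>\<close> nonadj \<rho>_late by (auto simp del: cop_at.simps)
    ultimately have "running c0 s \<rho> (Suc (Suc (Suc k)))"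
      by (auto simp: running_def le_Suc_eq simp del: cop_at.simps)
    then have "robs c0 s \<rho> \<gamma> (Suc (Suc k))"
      using \<rho>_late by (auto simp: robs_def running_def simp del: cop_at.simps)
    then have "Suc (Suc k) < ?T \<gamma>"
      by (rule robs_before_visit_time[OF prot \<gamma>_V play_\<rho>])
    then show False
      using \<gamma>(2) k(1) by simp
  qed
  show thesis
    using that \<mu>_V \<mu>_earlier \<mu>_adj by blast
qed

theorem theorem12:
  fixes V :: "'a set" and E :: "'a rel"
  assumes "reflexive_graph V E"
    and "\<exists>c0 s. cop_strategy V E c0 s \<and> protective V E c0 s"
  shows "constructible V E"
proof -
  obtain c0 s where strat: "cop_strategy V E c0 s" and prot: "protective V E c0 s"
    using assms(2) by blast
  let ?T = "visit_time V E c0 s"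
  obtain r where r: "well_order_on V r"
    and r_mono: "\<And>x y. (x, y) \<in> r \<Longrightarrow> ?T x \<le> ?T y"
    and r_less: "\<And>x y. x \<in> V \<Longrightarrow> y \<in> V \<Longrightarrow> ?T x < ?T y \<Longrightarrow> (x, y) \<in> r"
    using ex_well_order_refining_rank[of V ?T] by blast
  have r_refl: "(x, x) \<in> r" if "x \<in> V" for x
    using r that by (auto simp: order_on_defs refl_on_def)
  have E_refl: "(x, x) \<in> E" if "x \<in> V" for x
    using assms(1) that by (auto simp: reflexive_graph_def refl_on_def)
  have "\<exists>\<mu>\<in>under r \<nu>. dominates (Restr E (under r \<nu>)) \<mu> \<nu>"
    if \<nu>: "\<nu> \<in> V" and not_least: "\<not> (\<forall>\<gamma>\<in>V. (\<nu>, \<gamma>) \<in> r)" for \<nu>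
  proof -
    \<comment> \<open>The cop's starting vertex is the least one, being the only vertex of rank 0.\<close>
    have "(c0, \<gamma>) \<in> r" if "\<gamma> \<in> V" for \<gamma>
    proof (cases "\<gamma> = c0")
      case True
      then show ?thesis
        using r_refl that by simp
    next
      case False
      have "c0 \<in> V"
        using strat by (simp add: cop_strategy_def)
      then have "?T c0 < ?T \<gamma>"
        using visit_time_eq_0_iff[OF assms(1) prot] that False by (metis gr0I)
      then show ?thesis
        using r_less \<open>c0 \<in> V\<close> that by blast
    qed
    then have "\<nu> \<noteq> c0"
      using not_least by blast
    then obtain \<mu> where \<mu>: "\<mu> \<in> V" "?T \<mu> < ?T \<nu>"
      and adj: "\<And>\<gamma>. (\<nu>, \<gamma>) \<in> E \<Longrightarrow> ?T \<gamma> \<le> ?T \<nu> \<Longrightarrow> (\<mu>, \<gamma>) \<in> E"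
      using dominating_cop_position[OF assms(1) strat prot \<nu>] by blast
    have "\<mu> \<in> under r \<nu>" "\<nu> \<in> under r \<nu>" "\<mu> \<noteq> \<nu>"
      using r_less[OF \<mu>(1) \<nu> \<mu>(2)] r_refl[OF \<nu>] \<mu>(2) by (auto simp: under_def)
    moreover have "(\<mu>, \<nu>) \<in> E"
      using adj E_refl[OF \<nu>] by simp
    moreover have "(\<mu>, \<gamma>) \<in> E" if "(\<nu>, \<gamma>) \<in> E" "\<gamma> \<in> under r \<nu>" for \<gamma>
      using adj that r_mono by (simp add: under_def)
    ultimately show ?thesis
      unfolding dominates_def by blast
  qed
  then show ?thesis
    unfolding constructible_def using r by blast
qed

end
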